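(* Let $\mathcal{L}$ be a lattice with least element $\bot$ whose height function is $p$-incremental, i.e. $h(X\vee a)-h(X)\le p$ for all $X\in\mathcal{L}$ and all $a\in\mathrm{adm}(X)$. Let $k$ be a positive integer and $\mathcal{F}=\{X\in\mathcal{L}: h(X)\le k\}$. Let $f\colon\mathcal{L}\to\mathbb{R}$ be a monotone function with $f(\bot)=0$ that is downward DR-submodular with additive gap $\delta$. Consider the greedy algorithm: set $X=\bot$; for $i=1,\dots,k$, choose $a_i\in\operatorname{argmax}_{a\in\mathrm{adm}(X),\,X\vee a\in\mathcal{F}} f(X\vee a)$ and set $X\leftarrow X\vee a_i$; return $X$ (each argmax is assumed to be attained). Then the returned $X$ is a $\bigl(1-e^{-\lfloor k/p\rfloor/k},\ \delta(1-e^{-\lfloor k/p\rfloor/k})k\bigr)$-approximate solution of the problem $\max\{f(X): X\in\mathcal{F}\}$, i.e. $$f(X)\ \ge\ \bigl(1-e^{-\lfloor k/p\rfloor/k}\bigr)\max_{X'\in\mathcal{F}}f(X')\;-\;\delta\bigl(1-e^{-\lfloor k/p\rfloor/k}\bigr)k.$$ In particular, if $\mathcal{L}$ is a modular lattice and $\delta=0$, the algorithm gives a $(1-1/e)$-approximation.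
   Context: A lattice $(\mathcal{L},\le)$ is a poset in which any two elements $X,Y$ have a least upper bound (join) $X\vee Y$ and greatest lower bound (meet) $X\wedge Y$; here it has a least element $\bot$. A lattice is modular if $X\le B$ implies $X\vee(A\wedge B)=(X\vee A)\wedge B$. A chain $X_1<\dots<X_k$ is a composition series if there is no $Y$ with $X_i<Y<X_{i+1}$ for any $i$; the height $h(X)$ of $X$ is the length of the longest composition series from $\bot$ to $X$. An element $a$ is join-irreducible if there are no $X\neq a$, $Y\neq a$ with $a=X\vee Y$; $J(\mathcal{L})$ is the set of join-irreducible elements. For $X\in\mathcal{L}$, $a\in J(\mathcal{L})$ is admissible with respect to $X$ if $a\not\le X$ and every $a'\in\mathcal{L}$ with $a'<a$ satisfies $a'\le X$; $\mathrm{adm}(X)$ denotes the set of such elements. For $b\in\mathrm{adm}(Y)$, the closure is $\mathrm{cl}(b\mid Y)=\{b'\in\mathrm{adm}(Y): Y\vee b=Y\vee b'\}$. A function $f\colon\mathcal{L}\to\mathbb{R}$ is monotone if $X\le Y$ implies $f(X)\le f(Y)$. It is downward DR-submodular with additive gap $\delta$ if for all $X\le Y$ in $\mathcal{L}$ and all $b\in\mathrm{adm}(Y)$, $$f(Y\vee b)-f(Y)\le \max_{b'\in\mathrm{cl}(b\mid Y)}\ \min_{a\in\mathrm{adm}(X),\,a\le b'}\bigl(f(X\vee a)-f(X)\bigr)+\delta.$$ A feasible $X$ is an $(\alpha,\delta')$-approximate solution if $f(X)\ge\alpha\max_{X'\in\mathcal{F}}f(X')-\delta'$.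
   Formalization: Chains from ⊥ to each X are assumed to have bounded length (finite height; with dense chains the claim can fail), and δ ≥ 0 is assumed (automatic unless the lattice has one element); greedy leaves X unchanged when no feasible admissible element remains. *)

theory Defs
  imports Complex_Main "HOL-Library.Extended_Real"
begin

unbundle lattice_syntax

definition chain_from_to :: "'a::order \<Rightarrow> 'a \<Rightarrow> 'a list \<Rightarrow> bool" where
  "chain_from_to A B xs \<longleftrightarrow> sorted_wrt (<) xs \<and> xs \<noteq> [] \<and> hd xs = A \<and> last xs = B"

definition composition_series :: "'a::order list \<Rightarrow> bool" where
  "composition_series xs \<longleftrightarrow> sorted_wrt (<) xs \<and>
     (\<forall>i. Suc i < length xs \<longrightarrow> \<not> (\<exists>Y. xs ! i < Y \<and> Y < xs ! Suc i))"

text \<open>Without this the length of a longest composition series below \<open>X\<close> is not a meaningful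
  height: there may be no composition series at all, or all of them may be short although
  \<open>[\<bottom>, X]\<close> contains infinite (e.g. dense) chains.\<close>

definition finite_height :: "'a::bounded_lattice_bot \<Rightarrow> bool" where
  "finite_height X \<longleftrightarrow> (\<exists>n. \<forall>xs. chain_from_to \<bottom> X xs \<longrightarrow> length xs \<le> n)"

text \<open>The length of a series is its number of steps, so that \<open>\<bottom>\<close> has height \<open>0\<close>. The set is finite
  and nonempty when \<open>X\<close> has finite height.\<close>

definition height :: "'a::bounded_lattice_bot \<Rightarrow> nat" where
  "height X = Max {length xs - 1 | xs. composition_series xs \<and> chain_from_to \<bottom> X xs}"

definition join_irreducible :: "'a::lattice \<Rightarrow> bool" where
  "join_irreducible a \<longleftrightarrow> \<not> (\<exists>X Y. X \<noteq> a \<and> Y \<noteq> a \<and> a = X \<squnion> Y)"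

definition adm :: "'a::lattice \<Rightarrow> 'a set" where
  "adm X = {a. join_irreducible a \<and> \<not> a \<le> X \<and> (\<forall>a'. a' < a \<longrightarrow> a' \<le> X)}"

definition cl :: "'a::lattice \<Rightarrow> 'a \<Rightarrow> 'a set" where
  "cl b Y = {b' \<in> adm Y. Y \<squnion> b = Y \<squnion> b'}"

text \<open>The sets may be infinite, so max and min are read as supremum and infimum in the extended
  reals; this agrees with max and min whenever these are attained. If \<open>f\<close> is monotone and all
  elements have finite height, both sets are nonempty and both bounds are finite.\<close>

definition downward_DR_submodular :: "('a::lattice \<Rightarrow> real) \<Rightarrow> real \<Rightarrow> bool" where
  "downward_DR_submodular f \<delta> \<longleftrightarrow>
     (\<forall>X Y. X \<le> Y \<longrightarrow> (\<forall>b \<in> adm Y.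
        ereal (f (Y \<squnion> b) - f Y) \<le>
          (SUP b' \<in> cl b Y. INF a \<in> {a \<in> adm X. a \<le> b'}. ereal (f (X \<squnion> a) - f X)) + ereal \<delta>))"

definition modular_lattice :: "'a::lattice itself \<Rightarrow> bool" where
  "modular_lattice _ \<longleftrightarrow> (\<forall>X A B :: 'a. X \<le> B \<longrightarrow> X \<squnion> (A \<sqinter> B) = (X \<squnion> A) \<sqinter> B)"

definition incremental_height :: "'a::bounded_lattice_bot itself \<Rightarrow> nat \<Rightarrow> bool" where
  "incremental_height _ p \<longleftrightarrow>
     (\<forall>X :: 'a. \<forall>a \<in> adm X. int (height (X \<squnion> a)) - int (height X) \<le> int p)"

definition greedy_candidates :: "'a::lattice set \<Rightarrow> 'a \<Rightarrow> 'a set" where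
  "greedy_candidates F X = {a \<in> adm X. X \<squnion> a \<in> F}"

text \<open>The algorithm stays at \<open>X\<close> when no admissible element can be added feasibly (this does happen
  before the last round when a step may raise the height by more than one). If there are
  candidates but the maximum is not attained, there is no successor.\<close>

definition greedy_step :: "('a::lattice \<Rightarrow> real) \<Rightarrow> 'a set \<Rightarrow> 'a \<Rightarrow> 'a \<Rightarrow> bool" where
  "greedy_step f F X X' \<longleftrightarrow>
     (if greedy_candidates F X = {} then X' = X
      else \<exists>a. is_arg_max (\<lambda>a. f (X \<squnion> a)) (\<lambda>a. a \<in> greedy_candidates F X) a \<and> X' = X \<squnion> a)"

definition greedy_output :: "('a::bounded_lattice_bot \<Rightarrow> real) \<Rightarrow> 'a set \<Rightarrow> nat \<Rightarrow> 'a \<Rightarrow> bool" where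
  "greedy_output f F k X \<longleftrightarrow> (greedy_step f F ^^ k) \<bottom> X"

text \<open>As above, the maximum is the supremum in the extended reals.\<close>

definition approximate_solution :: "('a \<Rightarrow> real) \<Rightarrow> 'a set \<Rightarrow> real \<Rightarrow> real \<Rightarrow> 'a \<Rightarrow> bool" where
  "approximate_solution f F \<alpha> \<delta>' X \<longleftrightarrow>
     X \<in> F \<and> ereal (f X) \<ge> ereal \<alpha> * (SUP X' \<in> F. ereal (f X')) - ereal \<delta>'"

end

theory Submission
  imports Defs
begin

text \<open>
  Let \<open>S\<close> be feasible and let \<open>X\<close> be the current greedy iterate. A maximal chain from \<open>\<bottom>\<close> to \<open>S\<close> has
  at most \<open>k\<close> steps, each of which joins an element admissible for its lower end; joining the whole
  chain with \<open>X\<close> leads from \<open>X\<close> to \<open>X \<squnion> S\<close> in at most \<open>k\<close> admissible steps. As long as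
  \<open>height X + p \<le> k\<close>, every element of \<open>adm X\<close> is a greedy candidate, so by downward DR-submodularity
  each of these steps gains at most the greedy gain plus \<open>\<delta>\<close>. Hence one greedy step multiplies
  the deficit \<open>f S - k \<delta> - f X\<close> by at most \<open>1 - 1/k\<close>, and this applies to the first \<open>\<lfloor>k/p\<rfloor>\<close> steps.
  In a modular lattice \<open>X \<squnion> a\<close> covers \<open>X\<close> for admissible \<open>a\<close>, and covers raise the height by one,
  so \<open>p = 1\<close>.
\<close>

section \<open>Height\<close>

text \<open>An element strictly between two neighbours could be inserted, giving a longer chain with
  the same ends.\<close>

lemma composition_series_if_longest:
  assumes "chain_from_to \<bottom> Z xs"
    and longest: "\<And>ys. chain_from_to \<bottom> Z ys \<Longrightarrow> length ys \<le> length xs"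
  shows "composition_series xs"
proof (rule ccontr)
  have srt: "sorted_wrt (<) xs" and ne: "xs \<noteq> []" and hd: "hd xs = \<bottom>" and last: "last xs = Z"
    using assms(1) by (auto simp: chain_from_to_def)
  assume "\<not> composition_series xs"
  then obtain i Y where i: "Suc i < length xs" and Y: "xs ! i < Y" "Y < xs ! Suc i"
    using srt by (auto simp: composition_series_def)
  let ?ys = "take (Suc i) xs @ Y # drop (Suc i) xs"
  have "sorted_wrt (<) ?ys"
  proof -
    have low: "x < Y" if x: "x \<in> set (take (Suc i) xs)" for x
    proof -
      obtain j where j: "j \<le> i" "x = xs ! j"
        using x i by (auto simp: in_set_conv_nth less_Suc_eq_le)
      then have "x \<le> xs ! i"
        using srt i by (cases "j = i") (auto simp: sorted_wrt_iff_nth_less less_imp_le)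
      then show ?thesis using Y(1) by simp
    qed
    have high: "Y < x" if x: "x \<in> set (drop (Suc i) xs)" for x
    proof -
      obtain j where "j < length xs - Suc i" "x = xs ! (Suc i + j)"
        using x by (auto simp: in_set_conv_nth)
      then obtain j where j: "Suc i \<le> j" "j < length xs" "x = xs ! j"
        by (metis add.commute le_add1 less_diff_conv)
      then have "xs ! Suc i \<le> x"
        using srt by (cases "j = Suc i") (auto simp: sorted_wrt_iff_nth_less less_imp_le)
      then show ?thesis using Y(2) by simp
    qed
    show ?thesis
      using srt less_trans[OF low high]
      by (simp add: sorted_wrt_append sorted_wrt_take sorted_wrt_drop low high)
  qed
  moreover have "hd ?ys = \<bottom>" using ne hd by (cases xs) auto
  moreover have "last ?ys = Z" using i last by simp
  ultimately have "chain_from_to \<bottom> Z ?ys"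
    by (simp add: chain_from_to_def)
  from longest[OF this] i show False by simp
qed

lemma finite_chain_lengths:
  assumes "finite_height Z"
  shows "finite {length xs - 1 | xs. chain_from_to \<bottom> Z xs}"
proof -
  obtain n where "\<And>xs. chain_from_to \<bottom> Z xs \<Longrightarrow> length xs \<le> n"
    using assms by (auto simp: finite_height_def)
  then have "{length xs - 1 | xs. chain_from_to \<bottom> Z xs} \<subseteq> {..n}"
    by (auto intro: le_trans[OF diff_le_self])
  then show ?thesis by (rule finite_subset) simp
qed

text \<open>\<open>height\<close> takes its maximum over composition series only. A longest chain
  among all chains is itself one, so the height also bounds arbitrary chains, and later arguments
  can use plain chains.\<close>

lemma obtain_longest_chain:
  assumes "finite_height Z"
  obtains xs where "chain_from_to \<bottom> Z xs" and "length xs = Suc (height Z)"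
    and "\<And>ys. chain_from_to \<bottom> Z ys \<Longrightarrow> length ys \<le> Suc (height Z)"
proof -
  obtain n where n: "\<And>xs. chain_from_to \<bottom> Z xs \<Longrightarrow> length xs \<le> n"
    using assms by (auto simp: finite_height_def)
  \<comment> \<open>Some chain must exist; strictness forces the one-entry list when
    \<open>Z = \<bottom>\<close>.\<close>
  have "chain_from_to \<bottom> Z (if Z = \<bottom> then [\<bottom>] else [\<bottom>, Z])"
    by (simp add: chain_from_to_def order_less_le)
  then have "\<exists>xs. chain_from_to \<bottom> Z xs \<and> (\<forall>ys. chain_from_to \<bottom> Z ys \<longrightarrow> length ys \<le> length xs)"
    by (rule ex_has_greatest_nat[where b = "Suc n"]) (simp add: n less_Suc_eq_le)
  then obtain xs where xs: "chain_from_to \<bottom> Z xs"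
    and longest: "\<And>ys. chain_from_to \<bottom> Z ys \<Longrightarrow> length ys \<le> length xs"
    by blast
  have "composition_series xs"
    by (rule composition_series_if_longest[OF xs longest])
  then have "height Z = length xs - 1"
    unfolding height_def
  proof (intro Max_eqI)
    show "finite {length xs - 1 | xs. composition_series xs \<and> chain_from_to \<bottom> Z xs}"
      by (rule finite_subset[OF _ finite_chain_lengths[OF assms]]) blast
  qed (use xs in \<open>auto intro: diff_le_mono longest\<close>)
  moreover have "xs \<noteq> []" using xs by (simp add: chain_from_to_def)
  ultimately have "length xs = Suc (height Z)" by (cases xs) auto
  with xs longest show ?thesis by (intro that) auto
qed

lemma height_bot [simp]: "height (\<bottom> :: 'a::bounded_lattice_bot) = 0"
proof -
  have single: "xs = [\<bottom>]" if "chain_from_to \<bottom> (\<bottom> :: 'a) xs" for xs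
    using that by (cases xs)
      (auto simp: chain_from_to_def split: if_splits dest!: last_in_set)
  then have "finite_height (\<bottom> :: 'a)"
    by (auto simp: finite_height_def intro!: exI[of _ 1] dest!: single)
  from obtain_longest_chain[OF this] show ?thesis
    by (metis single length_Cons list.size(3) nat.inject)
qed

context
  assumes finite_height: "\<And>Z :: 'a::bounded_lattice_bot. finite_height Z"
begin

text \<open>A longest chain up to \<open>Y\<close> can be prolonged by \<open>Z\<close>.\<close>

lemma height_strict_mono:
  fixes Y Z :: 'a
  assumes "Y < Z"
  shows "height Y < height Z"
proof -
  obtain xs where xs: "chain_from_to \<bottom> Y xs" "length xs = Suc (height Y)"
    using obtain_longest_chain[OF finite_height] by metis
  have "x \<le> Y" if "x \<in> set xs" for x
    using xs(1) that by (cases xs rule: rev_cases)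
      (auto simp: chain_from_to_def sorted_wrt_append less_imp_le)
  then have "chain_from_to \<bottom> Z (xs @ [Z])"
    using xs(1) assms by (auto simp: chain_from_to_def sorted_wrt_append intro: le_less_trans)
  then have "length (xs @ [Z]) \<le> Suc (height Z)"
    using obtain_longest_chain[OF finite_height] by metis
  then show ?thesis using xs(2) by simp
qed

lemma height_mono:
  fixes Y Z :: 'a
  shows "Y \<le> Z \<Longrightarrow> height Y \<le> height Z"
  using height_strict_mono[of Y Z] by (cases "Y = Z") (auto simp: order_less_le)

text \<open>The next-to-last entry of a longest chain up to \<open>Z\<close> will do. Such
  predecessors drive the later inductions on height.\<close>

lemma obtain_height_predecessor:
  fixes Z :: 'a
  assumes "Z \<noteq> \<bottom>"
  obtains Y where "Y < Z" and "height Z = Suc (height Y)"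
proof -
  obtain xs where xs: "chain_from_to \<bottom> Z xs" "length xs = Suc (height Z)"
    using obtain_longest_chain[OF finite_height] by metis
  obtain ys where ys: "xs = ys @ [Z]"
    using xs(1) by (cases xs rule: rev_cases) (auto simp: chain_from_to_def)
  have "ys \<noteq> []" using xs(1) assms ys by (auto simp: chain_from_to_def)
  then have chain: "chain_from_to \<bottom> (last ys) ys" and less: "last ys < Z"
    using xs(1) ys by (auto simp: chain_from_to_def sorted_wrt_append)
  have "length ys \<le> Suc (height (last ys))"
    using obtain_longest_chain[OF finite_height] chain by metis
  then have "height Z \<le> Suc (height (last ys))"
    using xs(2) ys by simp
  with height_strict_mono[OF less] have "height Z = Suc (height (last ys))" by simp
  with less show ?thesis by (rule that)
qed

section \<open>Admissible elements\<close>

text \<open>Take \<open>a\<close> of least height among the elements below \<open>b\<close> but not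
  below \<open>X\<close>: anything strictly smaller lies below \<open>X\<close>, and two such
  elements cannot join to \<open>a\<close>.\<close>

lemma obtain_admissible_below:
  fixes b X :: 'a
  assumes "\<not> b \<le> X"
  obtains a where "a \<in> adm X" and "a \<le> b"
proof -
  obtain a where a: "a \<le> b" "\<not> a \<le> X"
    and least: "\<And>c. c \<le> b \<Longrightarrow> \<not> c \<le> X \<Longrightarrow> height a \<le> height c"
    using ex_has_least_nat[of "\<lambda>a. a \<le> b \<and> \<not> a \<le> X" b height] assms by auto
  have below: "c \<le> X" if "c < a" for c
    using least[of c] height_strict_mono[OF that] that a(1) by force
  have "join_irreducible a"
    unfolding join_irreducible_def
  proof (rule notI, elim exE conjE)
    fix Y Z assume "Y \<noteq> a" "Z \<noteq> a" and eq: "a = Y \<squnion> Z"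
    then have "Y < a" "Z < a" unfolding order_less_le by auto
    then have "Y \<squnion> Z \<le> X" using below by simp
    with a(2) eq show False by simp
  qed
  with a below show ?thesis by (intro that) (auto simp: adm_def)
qed

text \<open>No \<open>b'\<close> in the closure lies below \<open>Y\<close>, hence none lies below
  \<open>X\<close>; so each infimum ranges over at least one admissible \<open>a\<close>, whose gain
  is at most \<open>g\<close>.\<close>

lemma DR_gain_le:
  fixes f :: "'a \<Rightarrow> real"
  assumes "downward_DR_submodular f \<delta>" and "X \<le> Y" and "b \<in> adm Y"
    and gain: "\<And>a. a \<in> adm X \<Longrightarrow> f (X \<squnion> a) - f X \<le> g"
  shows "f (Y \<squnion> b) - f Y \<le> g + \<delta>"
proof -
  have "(SUP b' \<in> cl b Y. INF a \<in> {a \<in> adm X. a \<le> b'}. ereal (f (X \<squnion> a) - f X)) \<le> ereal g"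
  proof (rule SUP_least)
    fix b' assume "b' \<in> cl b Y"
    then have "\<not> b' \<le> X" using \<open>X \<le> Y\<close> by (auto simp: cl_def adm_def dest: order_trans)
    then obtain a where "a \<in> adm X" "a \<le> b'" by (rule obtain_admissible_below)
    then show "(INF a \<in> {a \<in> adm X. a \<le> b'}. ereal (f (X \<squnion> a) - f X)) \<le> ereal g"
      using gain by (intro INF_lower2[of a]) auto
  qed
  then have "(SUP b' \<in> cl b Y. INF a \<in> {a \<in> adm X. a \<le> b'}. ereal (f (X \<squnion> a) - f X)) + ereal \<delta>
      \<le> ereal g + ereal \<delta>"
    by (rule add_right_mono)
  moreover have "ereal (f (Y \<squnion> b) - f Y) \<le>
      (SUP b' \<in> cl b Y. INF a \<in> {a \<in> adm X. a \<le> b'}. ereal (f (X \<squnion> a) - f X)) + ereal \<delta>"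
    using assms(1-3) unfolding downward_DR_submodular_def by blast
  ultimately have "ereal (f (Y \<squnion> b) - f Y) \<le> ereal g + ereal \<delta>" by (rule order_trans[rotated])
  then show ?thesis by simp
qed

lemma DR_join_le:
  fixes f :: "'a \<Rightarrow> real"
  assumes "downward_DR_submodular f \<delta>" and "0 \<le> g + \<delta>"
    and gain: "\<And>a. a \<in> adm X \<Longrightarrow> f (X \<squnion> a) - f X \<le> g"
  shows "f (X \<squnion> Z) \<le> f X + real (height Z) * (g + \<delta>)"
proof (induction "height Z" arbitrary: Z)
  case 0
  then have "Z = \<bottom>" using obtain_height_predecessor[of Z] by fastforce
  then show ?case by simp
next
  case (Suc n)
  then have "Z \<noteq> \<bottom>" by auto
  then obtain W where W: "W < Z" "height Z = Suc (height W)"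
    by (rule obtain_height_predecessor)
  obtain b where b: "b \<in> adm W" "b \<le> Z"
    using obtain_admissible_below[of Z W] W(1) by (auto simp: less_le_not_le)
  \<comment> \<open>The heights of \<open>W\<close> and \<open>Z\<close> differ by one, so nothing
    lies strictly between them.\<close>
  have "W \<squnion> b = Z"
  proof (rule ccontr)
    assume "W \<squnion> b \<noteq> Z"
    moreover have "W < W \<squnion> b" using b(1) by (simp add: adm_def less_le_not_le)
    ultimately have "height W < height (W \<squnion> b)" "height (W \<squnion> b) < height Z"
      using W(1) b(2) by (simp_all add: height_strict_mono order.strict_iff_order[of "W \<squnion> b"])
    with W(2) show False by simp
  qed
  then have XZ: "X \<squnion> Z = (X \<squnion> W) \<squnion> b" by (simp add: sup_assoc)
  \<comment> \<open>Joining with \<open>X\<close> may swallow \<open>b\<close>, a step of gain zero;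
    otherwise \<open>b\<close> stays admissible, since everything strictly below it is below
    \<open>W\<close>.\<close>
  have "f ((X \<squnion> W) \<squnion> b) - f (X \<squnion> W) \<le> g + \<delta>"
  proof (cases "b \<le> X \<squnion> W")
    case True
    then show ?thesis using assms(2) by (simp add: sup_absorb1)
  next
    case False
    then have "b \<in> adm (X \<squnion> W)" using b(1) by (auto simp: adm_def intro: le_supI2)
    then show ?thesis by (intro DR_gain_le[OF assms(1) _ _ gain]) auto
  qed
  moreover have "f (X \<squnion> W) \<le> f X + real (height W) * (g + \<delta>)"
    using Suc W(2) by simp
  ultimately show ?case using XZ W(2) by (simp add: algebra_simps)
qed

section \<open>Modular lattices\<close>

text \<open>The case \<open>Z = W\<close> bounds the height of a cover \<open>W\<close> of
  \<open>X\<close>; the induction on height needs all \<open>Z\<close> below \<open>W\<close>. For a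
  predecessor \<open>V\<close> of \<open>Z\<close> not below \<open>X\<close>, modularity makes
  \<open>V \<sqinter> X\<close> strictly smaller than \<open>Z \<sqinter> X\<close>, which pays for
  the step from \<open>V\<close> to \<open>Z\<close>.\<close>

lemma modular_height_le_inf:
  fixes X Z :: 'a
  assumes modular: "modular_lattice TYPE('a)"
    and cover: "\<And>Y. X < Y \<Longrightarrow> Y \<le> W \<Longrightarrow> Y = W"
    and "X \<le> W"
  shows "Z \<le> W \<Longrightarrow> \<not> Z \<le> X \<Longrightarrow> height Z \<le> Suc (height (Z \<sqinter> X))"
proof (induction "height Z" arbitrary: Z rule: less_induct)
  case less
  then have "Z \<noteq> \<bottom>" by auto
  then obtain V where V: "V < Z" "height Z = Suc (height V)"
    by (rule obtain_height_predecessor)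
  show ?case
  proof (cases "V \<le> X")
    case True
    then have "height V \<le> height (Z \<sqinter> X)" using V(1) by (intro height_mono) auto
    then show ?thesis using V(2) by simp
  next
    case False
    have "V \<le> W" using V(1) less.prems(1) by simp
    then have IH: "height V \<le> Suc (height (V \<sqinter> X))" using less.hyps V(2) False by simp
    have "X < X \<squnion> V" using False by (simp add: less_le_not_le)
    then have "X \<squnion> V = W" using cover \<open>X \<le> W\<close> \<open>V \<le> W\<close> by simp
    moreover have "V \<squnion> (X \<sqinter> Z) = (V \<squnion> X) \<sqinter> Z"
      using modular V(1) by (simp add: modular_lattice_def)
    ultimately have "V \<squnion> (X \<sqinter> Z) = Z"
      using less.prems(1) by (simp add: sup_commute inf_absorb2)
    \<comment> \<open>Equality would put \<open>X \<sqinter> Z\<close> below \<open>V\<close>,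
      collapsing the join to \<open>V\<close>.\<close>
    then have "V \<sqinter> X \<noteq> Z \<sqinter> X"
      using V(1) by (metis inf_commute inf_le1 less_irrefl sup_absorb1)
    then have "V \<sqinter> X < Z \<sqinter> X"
      using inf_mono[OF less_imp_le[OF V(1)] order_refl, of X] by (simp add: order_less_le)
    from height_strict_mono[OF this] IH V(2) show ?thesis by simp
  qed
qed

lemma modular_incremental_height:
  assumes modular: "modular_lattice TYPE('a)"
  shows "incremental_height TYPE('a) 1"
  unfolding incremental_height_def
proof (intro allI ballI)
  fix X a :: 'a
  assume a: "a \<in> adm X"
  \<comment> \<open>\<open>X \<squnion> a\<close> covers \<open>X\<close>: by modularity
    \<open>Y\<close> is the join of \<open>X\<close> and \<open>a \<sqinter> Y\<close>, and the
    latter is \<open>a\<close> itself or already below \<open>X\<close>.\<close>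
  have "Y = X \<squnion> a" if Y: "X < Y" "Y \<le> X \<squnion> a" for Y
  proof -
    have eq: "X \<squnion> (a \<sqinter> Y) = Y"
      using modular Y by (simp add: modular_lattice_def inf_absorb2 less_imp_le)
    have "a \<sqinter> Y = a"
    proof (rule ccontr)
      assume "a \<sqinter> Y \<noteq> a"
      then have "a \<sqinter> Y \<le> X" using a by (simp add: adm_def order_less_le)
      then show False using eq Y(1) by (simp add: sup_absorb1)
    qed
    then show ?thesis using eq by simp
  qed
  then have "height (X \<squnion> a) \<le> Suc (height ((X \<squnion> a) \<sqinter> X))"
    using a by (intro modular_height_le_inf[OF modular, where W = "X \<squnion> a"]) (auto simp: adm_def)
  then show "int (height (X \<squnion> a)) - int (height X) \<le> int 1"
    by (simp add: inf_absorb2)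
qed

section \<open>The greedy algorithm\<close>

lemma greedy_step_mono:
  fixes f :: "'a \<Rightarrow> real"
  assumes "greedy_step f F X X'"
  shows "X \<le> X'"
  using assms by (auto simp: greedy_step_def split: if_splits)

text \<open>Since \<open>feasible\<close> makes all of \<open>adm X\<close> available, the greedy
  gain dominates every admissible gain. Monotonicity and \<open>\<delta> \<ge> 0\<close> keep the
  bound per step nonnegative, so \<open>height S\<close> may be replaced by
  \<open>k\<close>.\<close>

lemma greedy_step_gain:
  fixes f :: "'a \<Rightarrow> real"
  assumes "mono f" and "\<delta> \<ge> 0" and "downward_DR_submodular f \<delta>"
    and "greedy_step f F X X'" and feasible: "\<And>a. a \<in> adm X \<Longrightarrow> X \<squnion> a \<in> F"
    and "height S \<le> k"
  shows "f S \<le> f X + real k * (f X' - f X + \<delta>)"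
proof -
  have "greedy_candidates F X = adm X"
    using feasible by (auto simp: greedy_candidates_def)
  then have gain: "f (X \<squnion> a) - f X \<le> f X' - f X" if "a \<in> adm X" for a
    using assms(4) that by (auto simp: greedy_step_def is_arg_max_linorder split: if_splits)
  have nonneg: "0 \<le> f X' - f X + \<delta>"
    using monoD[OF \<open>mono f\<close> greedy_step_mono[OF assms(4)]] \<open>\<delta> \<ge> 0\<close> by simp
  have "f S \<le> f (X \<squnion> S)" using \<open>mono f\<close> by (simp add: monoD)
  also have "\<dots> \<le> f X + real (height S) * (f X' - f X + \<delta>)"
    by (rule DR_join_le[OF assms(3) nonneg gain])
  also have "\<dots> \<le> f X + real k * (f X' - f X + \<delta>)"
    using nonneg \<open>height S \<le> k\<close> by (intro add_left_mono mult_right_mono) auto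
  finally show ?thesis .
qed

text \<open>The height bound \<open>i * p\<close> leaves room for any admissible element in the
  first \<open>k div p\<close> rounds, each of which contracts the deficit; afterwards the exponent
  is frozen and monotonicity suffices.\<close>

lemma greedy_invariant:
  fixes f :: "'a \<Rightarrow> real"
  assumes "k > 0" and F: "F = {Z. height Z \<le> k}"
    and "mono f" and "f \<bottom> = 0" and "\<delta> \<ge> 0" and "downward_DR_submodular f \<delta>"
    and incr: "incremental_height TYPE('a) p" and "height S \<le> k"
  shows "(greedy_step f F ^^ i) \<bottom> X \<Longrightarrow>
    height X \<le> k \<and> height X \<le> i * p \<and>
    f S - k * \<delta> - f X \<le> (1 - 1 / k) ^ min i (k div p) * (f S - k * \<delta>)"
proof (induction i arbitrary: X)
  case 0
  then show ?case using \<open>f \<bottom> = 0\<close> by simp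
next
  case (Suc i)
  then obtain Y where Y: "(greedy_step f F ^^ i) \<bottom> Y" and step: "greedy_step f F Y X" by auto
  note IH = Suc.IH[OF Y]
  have join: "height (Y \<squnion> a) \<le> height Y + p" if "a \<in> adm Y" for a
    using incr that by (force simp: incremental_height_def)
  have "height X \<le> k \<and> height X \<le> Suc i * p"
  proof (cases "greedy_candidates F Y = {}")
    case True
    then show ?thesis using step IH by (auto simp: greedy_step_def)
  next
    case False
    then obtain a where "a \<in> greedy_candidates F Y" "X = Y \<squnion> a"
      using step by (auto simp: greedy_step_def is_arg_max_def)
    then show ?thesis using join[of a] IH F by (auto simp: greedy_candidates_def)
  qed
  moreover have "f S - k * \<delta> - f X \<le> (1 - 1 / k) ^ min (Suc i) (k div p) * (f S - k * \<delta>)"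
  proof (cases "i < k div p")
    case True
    have "Suc i * p \<le> k div p * p" using True by (intro mult_right_mono) auto
    also have "\<dots> \<le> k" by simp
    finally have "height Y + p \<le> k" using IH by simp
    then have "Y \<squnion> a \<in> F" if "a \<in> adm Y" for a
      using join[OF that] F by simp
    then have "f S \<le> f Y + real k * (f X - f Y + \<delta>)"
      using assms step by (intro greedy_step_gain) auto
    \<comment> \<open>Dividing by \<open>k\<close> and rearranging turns the gain bound into a
      contraction of the deficit.\<close>
    then have "f S - k * \<delta> - f X \<le> (1 - 1 / k) * (f S - k * \<delta> - f Y)"
      using \<open>k > 0\<close> by (simp add: field_simps)
    also have "\<dots> \<le> (1 - 1 / k) * ((1 - 1 / k) ^ min i (k div p) * (f S - k * \<delta>))"
      using IH \<open>k > 0\<close> by (intro mult_left_mono) auto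
    finally show ?thesis using True by (simp add: min_def mult.assoc)
  next
    case False
    then have "min (Suc i) (k div p) = min i (k div p)" by simp
    then show ?thesis
      using IH monoD[OF \<open>mono f\<close> greedy_step_mono[OF step]] by simp
  qed
  ultimately show ?case by simp
qed

lemma greedy_bound:
  fixes f :: "'a \<Rightarrow> real"
  assumes "k > 0" and F: "F = {Z. height Z \<le> k}"
    and "mono f" and "f \<bottom> = 0" and "\<delta> \<ge> 0" and "downward_DR_submodular f \<delta>"
    and incr: "incremental_height TYPE('a) p" and "height S \<le> k"
    and "greedy_output f F k X"
  shows "height X \<le> k"
    and "(1 - exp (- (real (k div p) / k))) * (f S - k * \<delta>) \<le> f X"
proof -
  have inv: "height X \<le> k \<and> height X \<le> k * p \<and>
    f S - k * \<delta> - f X \<le> (1 - 1 / k) ^ min k (k div p) * (f S - k * \<delta>)"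
    using assms by (intro greedy_invariant) (auto simp: greedy_output_def)
  then show "height X \<le> k" by simp
  \<comment> \<open>A negative \<open>f S - k * \<delta>\<close> would reverse the estimate of the
    power; the left side is then nonpositive, while \<open>f X\<close> is nonnegative.\<close>
  show "(1 - exp (- (real (k div p) / k))) * (f S - k * \<delta>) \<le> f X"
  proof (cases "f S - k * \<delta> \<ge> 0")
    case True
    \<comment> \<open>This is \<open>1 + x \<le> exp x\<close> at
      \<open>x = - (1 / k)\<close>.\<close>
    have "(1 - 1 / real k) ^ (k div p) \<le> exp (- (1 / k)) ^ (k div p)"
      using \<open>k > 0\<close> exp_ge_add_one_self[of "- (1 / real k)"] by (intro power_mono) auto
    also have "\<dots> = exp (- (real (k div p) / k))"
      by (simp add: exp_of_nat_mult[symmetric])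
    finally have "(1 - 1 / real k) ^ (k div p) * (f S - k * \<delta>)
        \<le> exp (- (real (k div p) / k)) * (f S - k * \<delta>)"
      using True by (intro mult_right_mono) auto
    moreover have "min k (k div p) = k div p" by (simp add: min_absorb2)
    ultimately show ?thesis using inv by (simp add: algebra_simps)
  next
    case False
    then have "(1 - exp (- (real (k div p) / k))) * (f S - k * \<delta>) \<le> 0"
      by (intro mult_nonneg_nonpos) auto
    also have "0 \<le> f X" using monoD[OF \<open>mono f\<close>, of \<bottom> X] \<open>f \<bottom> = 0\<close> by simp
    finally show ?thesis .
  qed
qed

end

text \<open>For positive \<open>\<alpha>\<close>, divide the bound by \<open>\<alpha>\<close> before
  taking the supremum. For \<open>\<alpha> = 0\<close> the product is \<open>0\<close> in the
  extended reals, whatever the supremum is.\<close>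

lemma approximate_solutionI:
  assumes "X \<in> F" and "\<alpha> \<ge> 0" and "0 \<le> f X + \<delta>'"
    and bound: "\<And>S. S \<in> F \<Longrightarrow> \<alpha> * f S - \<delta>' \<le> f X"
  shows "approximate_solution f F \<alpha> \<delta>' X"
proof -
  have "ereal \<alpha> * (SUP S \<in> F. ereal (f S)) \<le> ereal (f X + \<delta>')"
  proof (cases "\<alpha> = 0")
    case True
    then show ?thesis using assms(3) by (simp add: zero_ereal_def[symmetric])
  next
    case False
    then have "\<alpha> > 0" using assms(2) by simp
    have "(SUP S \<in> F. ereal (f S)) \<le> ereal ((f X + \<delta>') / \<alpha>)"
      using bound \<open>\<alpha> > 0\<close> by (intro SUP_least) (force simp: field_simps)
    then have "ereal \<alpha> * (SUP S \<in> F. ereal (f S)) \<le> ereal \<alpha> * ereal ((f X + \<delta>') / \<alpha>)"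
      using \<open>\<alpha> > 0\<close> by (intro ereal_mult_left_mono) auto
    then show ?thesis using \<open>\<alpha> > 0\<close> by simp
  qed
  then show ?thesis
    using assms(1) by (simp add: approximate_solution_def ereal_minus_le_iff add.commute)
qed

theorem theorem1:
  fixes f :: "'a::bounded_lattice_bot \<Rightarrow> real" and \<delta> :: real and k p :: nat
    and F :: "'a set" and X :: 'a
  assumes "\<forall>Z :: 'a. finite_height Z"
    and "k > 0"
    and "F = {Z. height Z \<le> k}"
    and "mono f" and "f \<bottom> = 0"
    and "\<delta> \<ge> 0" and "downward_DR_submodular f \<delta>"
    and "greedy_output f F k X"
  shows "(p > 0 \<and> incremental_height TYPE('a) p \<longrightarrow>
            approximate_solution f F
              (1 - exp (- (real_of_int \<lfloor>real k / real p\<rfloor> / real k)))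
              (\<delta> * (1 - exp (- (real_of_int \<lfloor>real k / real p\<rfloor> / real k))) * real k) X)
       \<and> (modular_lattice TYPE('a) \<and> \<delta> = 0 \<longrightarrow>
            approximate_solution f F (1 - 1 / exp 1) 0 X)"
proof -
  have fin: "finite_height Z" for Z :: 'a using assms(1) by simp
  \<comment> \<open>Stated for any \<open>p'\<close>, because it serves both the given
    \<open>p\<close> and the value \<open>1\<close> of modular lattices.\<close>
  have main: "approximate_solution f F (1 - exp (- (real q / k)))
      (\<delta> * (1 - exp (- (real q / k))) * k) X"
    if incr: "incremental_height TYPE('a) p'" and q: "q = k div p'" for p' q
  proof (rule approximate_solutionI)
    note bound = greedy_bound[OF fin assms(2-7) incr _ assms(8), folded q]
    \<comment> \<open>Feasibility of \<open>X\<close> does not involve \<open>S\<close>, so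
      \<open>\<bottom>\<close> serves as a feasible instance.\<close>
    show "X \<in> F" using bound(1)[of \<bottom>] assms(3) by simp
    show "0 \<le> 1 - exp (- (real q / k))" by simp
    then show "0 \<le> f X + \<delta> * (1 - exp (- (real q / k))) * k"
      using monoD[OF assms(4), of \<bottom> X] assms(5,6) by simp
    show "(1 - exp (- (real q / k))) * f S - \<delta> * (1 - exp (- (real q / k))) * k \<le> f X"
      if "S \<in> F" for S
      using bound(2)[of S] that assms(3) by (simp add: algebra_simps)
  qed
  have "approximate_solution f F (1 - 1 / exp 1) 0 X"
    if "modular_lattice TYPE('a)" "\<delta> = 0"
    \<comment> \<open>With \<open>p' = 1\<close> the exponent \<open>k div 1 / k\<close> is
      \<open>1\<close>.\<close>
    using main[OF modular_incremental_height[OF fin that(1)] refl] that(2) assms(2)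
    by (simp add: exp_minus inverse_eq_divide)
  moreover have "real_of_int \<lfloor>real k / real p\<rfloor> = real (k div p)"
    by (simp add: floor_divide_of_nat_eq)
  ultimately show ?thesis using main[OF _ refl, of p] by simp
qed

end
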